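(* Let $1\le m\le n$ be integers and let $\alpha,\beta$ be partitions with $|\alpha|=|\beta|$, $\ell(\alpha)\le m$ and $\ell(\beta)\le n$. Suppose either that $\alpha\ne\beta$, or that $\alpha=\beta$ and $\ell(\alpha)=m$. Then there exists a sign-reversing involution on $X'_{\alpha,\beta,m-1}$, i.e. a map $\varphi\colon X'_{\alpha,\beta,m-1}\to X'_{\alpha,\beta,m-1}$ with $\varphi\circ\varphi=\mathrm{id}$ and $\operatorname{sgn}(\varphi(\chi))=-\operatorname{sgn}(\chi)$ for all $\chi\in X'_{\alpha,\beta,m-1}$.
   Context: Partitions are identified with their Young diagrams (English notation; box $(i,j)$ is in row $i$, column $j$). $\mu'$ is the conjugate (transpose) of $\mu$, $\ell(\mu)$ its number of nonzero rows, $|\mu|$ its size, and $\emptyset$ the empty partition. The rank $r(\mu)$ is the greatest integer $k\ge 0$ with $\mu_k\ge k$ (side length of the Durfee square; $r(\emptyset)=0$). The $k$-stabilization $\mu_{(k)}$ is the partition obtained from $\mu$ by adding $k$ rows of length $r(\mu)$ (inserted so that the rows remain weakly decreasing). The notation $\mu\subseteq[a]\times[b]$ means that the diagram of $\mu$ fits in a rectangle with $a$ rows and $b$ columns, i.e. $\ell(\mu)\le a$ and $\mu_1\le b$. For partitions $\nu\subseteq\alpha$, a tableau of skew shape $\alpha/\nu$ is a filling of the boxes of $\alpha$ not in $\nu$ with positive integers; it is semistandard if rows weakly increase left to right and columns strictly increase top to bottom. Its content is $(c_1,c_2,\dots)$ with $c_i$ the number of labels equal to $i$. Its reverse reading word is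 obtained by reading the rows right to left, from top to bottom. A word is lattice if for every $i\ge1$ each initial segment contains at least as many $i$'s as $(i+1)$'s. A Littlewood--Richardson tableau is a semistandard tableau whose reverse reading word is lattice. $\mathrm{LR}(\alpha/\nu,\lambda)$ denotes the set of Littlewood--Richardson tableaux of shape $\alpha/\nu$ and content $\lambda$ (empty if $\nu\not\subseteq\alpha$). For fixed $m,n$, for $0\le k\le\min\{m,n\}$ and partitions $\alpha,\beta$ with $|\alpha|=|\beta|$, define $$X'_{\alpha,\beta,k}(\mu,\nu)=\mathrm{LR}(\alpha/\nu,\mu_{(k)})\times\mathrm{LR}(\beta/\nu,(\mu')_{(k)}),\qquad X'_{\alpha,\beta,k}=\bigsqcup_{\mu,\nu:\ \mu\subseteq[m-k]\times[n-k]}X'_{\alpha,\beta,k}(\mu,\nu),$$ where $\mu,\nu$ range over partitions. The sign of $\chi\in X'_{\alpha,\beta,k}(\mu,\nu)$ is $\operatorname{sgn}(\chi)=(-1)^{|\mu|}$. *)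

theory Defs
  imports Main "HOL-Library.FuncSet"
begin

text \<open>A partition is the weakly decreasing list of its nonzero rows; rows, columns and the
  letters of tableaux are numbered from 1.\<close>

definition is_partition :: "nat list \<Rightarrow> bool" where
  "is_partition \<mu> \<longleftrightarrow> sorted_wrt (\<ge>) \<mu> \<and> 0 \<notin> set \<mu>"

definition row :: "nat list \<Rightarrow> nat \<Rightarrow> nat" where
  "row \<mu> i = (if 1 \<le> i \<and> i \<le> length \<mu> then \<mu> ! (i - 1) else 0)"

definition diagram :: "nat list \<Rightarrow> (nat \<times> nat) set" where
  "diagram \<mu> = {(i, j). 1 \<le> i \<and> 1 \<le> j \<and> j \<le> row \<mu> i}"

definition conjugate :: "nat list \<Rightarrow> nat list" where
  "conjugate \<mu> = map (\<lambda>j. card {i. (i, j) \<in> diagram \<mu>}) [1..<Suc (row \<mu> 1)]"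

definition durfee_rank :: "nat list \<Rightarrow> nat" where
  "durfee_rank \<mu> = (GREATEST k. k = 0 \<or> k \<le> row \<mu> k)"

text \<open>The filter matters only for the empty partition, whose rank is 0: adding rows of length 0
  does not change it.\<close>

definition stabilization :: "nat \<Rightarrow> nat list \<Rightarrow> nat list" where
  "stabilization k \<mu> =
     rev (sort (filter (\<lambda>p. 0 < p) (\<mu> @ replicate k (durfee_rank \<mu>))))"

definition fits :: "nat list \<Rightarrow> nat \<Rightarrow> nat \<Rightarrow> bool" where
  "fits \<mu> a b \<longleftrightarrow> length \<mu> \<le> a \<and> row \<mu> 1 \<le> b"

definition skew :: "nat list \<Rightarrow> nat list \<Rightarrow> (nat \<times> nat) set" where
  "skew \<alpha> \<nu> = diagram \<alpha> - diagram \<nu>"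

text \<open>Fillings are extensional functions, so that they are determined by their entries in the
  shape.\<close>

definition tableaux :: "nat list \<Rightarrow> nat list \<Rightarrow> (nat \<times> nat \<Rightarrow> nat) set" where
  "tableaux \<alpha> \<nu> = skew \<alpha> \<nu> \<rightarrow>\<^sub>E {1..}"

definition semistandard :: "nat list \<Rightarrow> nat list \<Rightarrow> (nat \<times> nat \<Rightarrow> nat) \<Rightarrow> bool" where
  "semistandard \<alpha> \<nu> T \<longleftrightarrow>
     (\<forall>i j j'. (i, j) \<in> skew \<alpha> \<nu> \<and> (i, j') \<in> skew \<alpha> \<nu> \<and> j < j' \<longrightarrow> T (i, j) \<le> T (i, j')) \<and>
     (\<forall>i i' j. (i, j) \<in> skew \<alpha> \<nu> \<and> (i', j) \<in> skew \<alpha> \<nu> \<and> i < i' \<longrightarrow> T (i, j) < T (i', j))"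

definition has_content :: "nat list \<Rightarrow> nat list \<Rightarrow> (nat \<times> nat \<Rightarrow> nat) \<Rightarrow> nat list \<Rightarrow> bool" where
  "has_content \<alpha> \<nu> T \<kappa> \<longleftrightarrow> (\<forall>i\<ge>1. card {b \<in> skew \<alpha> \<nu>. T b = i} = row \<kappa> i)"

text \<open>For \<open>\<nu> \<subseteq> \<alpha>\<close>, row \<open>i\<close> of the skew shape occupies the columns from
  \<open>row \<nu> i + 1\<close> to \<open>row \<alpha> i\<close>.\<close>

definition reverse_word :: "nat list \<Rightarrow> nat list \<Rightarrow> (nat \<times> nat \<Rightarrow> nat) \<Rightarrow> nat list" where
  "reverse_word \<alpha> \<nu> T =
     concat (map (\<lambda>i. map (\<lambda>j. T (i, j)) (rev [Suc (row \<nu> i)..<Suc (row \<alpha> i)]))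
       [1..<Suc (length \<alpha>)])"

definition lattice_word :: "nat list \<Rightarrow> bool" where
  "lattice_word w \<longleftrightarrow>
     (\<forall>i\<ge>1. \<forall>p\<le>length w. count_list (take p w) (Suc i) \<le> count_list (take p w) i)"

definition LR :: "nat list \<Rightarrow> nat list \<Rightarrow> nat list \<Rightarrow> (nat \<times> nat \<Rightarrow> nat) set" where
  "LR \<alpha> \<nu> \<kappa> = {T \<in> tableaux \<alpha> \<nu>. diagram \<nu> \<subseteq> diagram \<alpha> \<and> semistandard \<alpha> \<nu> T \<and>
     has_content \<alpha> \<nu> T \<kappa> \<and> lattice_word (reverse_word \<alpha> \<nu> T)}"

type_synonym lr_quad =
  "(nat list \<times> nat list) \<times> (nat \<times> nat \<Rightarrow> nat) \<times> (nat \<times> nat \<Rightarrow> nat)"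

definition X' :: "nat \<Rightarrow> nat \<Rightarrow> nat list \<Rightarrow> nat list \<Rightarrow> nat \<Rightarrow> lr_quad set" where
  "X' m n \<alpha> \<beta> k =
     (SIGMA (\<mu>, \<nu>):{(\<mu>, \<nu>). is_partition \<mu> \<and> is_partition \<nu> \<and> fits \<mu> (m - k) (n - k)}.
        LR \<alpha> \<nu> (stabilization k \<mu>) \<times> LR \<beta> \<nu> (stabilization k (conjugate \<mu>)))"

definition quad_sign :: "lr_quad \<Rightarrow> int" where
  "quad_sign \<chi> = (case \<chi> of ((\<mu>, \<nu>), _) \<Rightarrow> (- 1) ^ sum_list \<mu>)"

end

theory Submission
  imports Defs
begin

text \<open>For \<open>k = m - 1\<close> the partition \<open>\<mu>\<close> is empty or a single row \<open>p\<close>, so that the two contents are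
  the hook \<open>(p, 1\<^sup>m\<^sup>-\<^sup>1)\<close> and the column \<open>1\<^sup>p\<^sup>+\<^sup>m\<^sup>-\<^sup>1\<close>. As \<open>\<alpha>\<close> has at most \<open>m\<close> rows, the letter \<open>i\<close> of a hook
  tableau must end row \<open>i\<close> and all other letters are 1. Hence \<open>\<nu>\<close> determines both tableaux, and they exist
  iff \<open>\<alpha>\<close> has \<open>m\<close> rows, \<open>\<beta>/\<nu>\<close> is a vertical strip and \<open>a/\<nu>\<close> is a horizontal strip, where \<open>a\<close> is \<open>\<alpha>\<close>
  without its first column. These conditions confine each row of \<open>\<nu>\<close>, independently of the others,
  to an interval of at most two values. Switching a fixed row with two choices reverses the sign. If
  no row has two choices, comparing sizes forces \<open>\<alpha> = \<beta>\<close>; then there is exactly one such \<open>\<nu>\<close>, which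
  is paired with the element for \<open>\<mu> = \<emptyset>\<close>.\<close>

section \<open>Partitions and their row functions\<close>

lemma row_0 [simp]: "row \<mu> 0 = 0"
  by (simp add: row_def)

lemma row_beyond: "length \<mu> < i \<Longrightarrow> row \<mu> i = 0"
  by (simp add: row_def)

lemma row_pos_iff:
  assumes "is_partition \<mu>"
  shows "0 < row \<mu> i \<longleftrightarrow> 1 \<le> i \<and> i \<le> length \<mu>"
proof -
  have "\<mu> ! (i - 1) \<noteq> 0" if "1 \<le> i" "i \<le> length \<mu>"
  proof -
    have "\<mu> ! (i - 1) \<in> set \<mu>" using that by simp
    then show ?thesis using assms by (metis is_partition_def)
  qed
  then show ?thesis by (auto simp: row_def)
qed

text \<open>The bound \<open>1 \<le> i\<close> excludes the default value
  \<open>row \<mu> 0 = 0\<close>.\<close>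

lemma row_antimono:
  assumes "is_partition \<mu>" "1 \<le> i" "i \<le> j"
  shows "row \<mu> j \<le> row \<mu> i"
proof (cases "i = j \<or> length \<mu> < j")
  case False
  then have "i - 1 < j - 1" "j - 1 < length \<mu>" using assms by auto
  then have "\<mu> ! (j - 1) \<le> \<mu> ! (i - 1)"
    using assms(1) sorted_wrt_nth_less[of "(\<ge>)" \<mu> "i - 1" "j - 1"]
    by (auto simp: is_partition_def)
  then show ?thesis using False assms by (auto simp: row_def)
qed (auto simp: row_beyond)

lemma partition_eqI:
  assumes "is_partition \<mu>" "is_partition \<nu>" "\<And>i. 1 \<le> i \<Longrightarrow> row \<mu> i = row \<nu> i"
  shows "\<mu> = \<nu>"
proof (rule nth_equalityI)
  have "i \<le> length \<mu> \<longleftrightarrow> i \<le> length \<nu>" if "1 \<le> i" for i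
    using row_pos_iff[OF assms(1), of i] row_pos_iff[OF assms(2), of i] assms(3)[OF that] that by simp
  from this[of "length \<mu>"] this[of "length \<nu>"] show len: "length \<mu> = length \<nu>"
    by (cases "length \<mu>"; cases "length \<nu>") auto
  show "\<mu> ! i = \<nu> ! i" if "i < length \<mu>" for i
    using assms(3)[of "Suc i"] that len by (simp add: row_def)
qed

lemma partition_of_rows:
  fixes f :: "nat \<Rightarrow> nat"
  assumes anti: "\<And>i. 1 \<le> i \<Longrightarrow> f (Suc i) \<le> f i" and zero: "f (Suc K) = 0"
  obtains \<mu> where "is_partition \<mu>" "\<And>i. 1 \<le> i \<Longrightarrow> row \<mu> i = f i"
proof
  \<comment> \<open>A decreasing \<open>f\<close> vanishes from its first zero on, so the values
    before that zero form the list of rows.\<close>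
  define L where "L = (LEAST l. f (Suc l) = 0)"
  have L: "f (Suc L) = 0" unfolding L_def by (rule LeastI[of _ K]) (rule zero)
  have pos: "f (Suc l) \<noteq> 0" if "l < L" for l
    using not_less_Least[of l "\<lambda>l. f (Suc l) = 0"] that by (simp add: L_def)
  have mono: "f j \<le> f i" if "1 \<le> i" "i \<le> j" for i j
    using that(2,1) by (induction rule: dec_induct) (auto intro: order_trans[OF anti])
  show "is_partition (map f [1..<Suc L])"
    unfolding is_partition_def
  proof
    show "sorted_wrt (\<ge>) (map f [1..<Suc L])"
      by (auto simp: sorted_wrt_iff_nth_less simp del: upt_Suc intro!: mono)
    have "f i \<noteq> 0" if "1 \<le> i" "i \<le> L" for i
      using pos[of "i - 1"] that by simp
    then show "0 \<notin> set (map f [1..<Suc L])" by force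
  qed
  show "row (map f [1..<Suc L]) i = f i" if "1 \<le> i" for i
    using that mono[of "Suc L" i] L by (auto simp: row_def simp del: upt_Suc)
qed

text \<open>The bound \<open>K\<close> is left free so that partitions of different lengths can be
  summed over one range and compared row by row.\<close>

lemma sum_list_rows:
  assumes "length \<mu> \<le> K"
  shows "sum_list \<mu> = (\<Sum>i=1..K. row \<mu> i)"
proof -
  have "sum_list \<mu> = (\<Sum>i<length \<mu>. \<mu> ! i)"
    by (simp add: sum_list_sum_nth atLeast0LessThan)
  also have "\<dots> = (\<Sum>i<length \<mu>. row \<mu> (Suc i))"
    by (rule sum.cong) (auto simp: row_def)
  also have "\<dots> = (\<Sum>i=1..length \<mu>. row \<mu> i)"
    by (rule sum.reindex_bij_witness[of _ "\<lambda>i. i - 1" Suc]) auto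
  also have "\<dots> = (\<Sum>i=1..K. row \<mu> i)"
    using assms by (intro sum.mono_neutral_left) (auto simp: row_beyond)
  finally show ?thesis .
qed

section \<open>Skew shapes and their sizes\<close>

lemma skew_iff: "(i, j) \<in> skew \<alpha> \<nu> \<longleftrightarrow> 1 \<le> i \<and> row \<nu> i < j \<and> j \<le> row \<alpha> i"
  by (auto simp: skew_def diagram_def)

lemma diagram_subset_iff: "diagram \<nu> \<subseteq> diagram \<alpha> \<longleftrightarrow> (\<forall>i. row \<nu> i \<le> row \<alpha> i)"
proof
  assume *: "diagram \<nu> \<subseteq> diagram \<alpha>"
  show "\<forall>i. row \<nu> i \<le> row \<alpha> i"
  proof
    fix i
    show "row \<nu> i \<le> row \<alpha> i"
      using subsetD[OF *, of "(i, row \<nu> i)"]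
      by (cases "row \<nu> i = 0"; cases "i = 0") (auto simp: diagram_def)
  qed
qed (auto simp: diagram_def intro: order_trans)

lemma skew_eq_Sigma:
  "skew \<alpha> \<nu> = (SIGMA i:{1..length \<alpha>}. {row \<nu> i<..row \<alpha> i})"
  by (auto simp: skew_iff not_less_eq_eq row_def split: if_splits)

lemma finite_skew [simp]: "finite (skew \<alpha> \<nu>)"
  by (simp add: skew_eq_Sigma)

text \<open>The additive form avoids truncated subtraction.\<close>

lemma card_skew:
  assumes "\<And>i. row \<nu> i \<le> row \<alpha> i" "length \<nu> \<le> length \<alpha>"
  shows "card (skew \<alpha> \<nu>) + sum_list \<nu> = sum_list \<alpha>"
  using assms
  by (simp add: skew_eq_Sigma sum_list_rows[of _ "length \<alpha>"] flip: sum.distrib)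

text \<open>The last row of \<nu> is nonempty, hence so is that row of \<alpha>.\<close>

lemma length_le_of_rows_le:
  assumes "is_partition \<nu>" "\<And>i. row \<nu> i \<le> row \<alpha> i"
  shows "length \<nu> \<le> length \<alpha>"
  using row_pos_iff[OF assms(1), of "length \<nu>"] assms(2)[of "length \<nu>"]
  by (cases "length \<nu> = 0") (auto simp: row_def split: if_splits)

section \<open>Reading order and lattice words\<close>

definition reads_before :: "nat \<times> nat \<Rightarrow> nat \<times> nat \<Rightarrow> bool" where
  "reads_before b c \<longleftrightarrow> fst b < fst c \<or> fst b = fst c \<and> snd c < snd b"

text \<open>Positions of the reverse reading word become boxes here, so that the lattice condition
  can be used geometrically.\<close>

definition reading_boxes :: "nat list \<Rightarrow> nat list \<Rightarrow> (nat \<times> nat) list" where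
  "reading_boxes \<alpha> \<nu> =
     concat (map (\<lambda>i. map (Pair i) (rev [Suc (row \<nu> i)..<Suc (row \<alpha> i)])) [1..<Suc (length \<alpha>)])"

lemma reverse_word_eq: "reverse_word \<alpha> \<nu> T = map T (reading_boxes \<alpha> \<nu>)"
  by (simp add: reverse_word_def reading_boxes_def map_concat o_def del: upt_Suc)

lemma set_reading_boxes: "set (reading_boxes \<alpha> \<nu>) = skew \<alpha> \<nu>"
  unfolding skew_eq_Sigma by (auto simp: reading_boxes_def image_iff simp del: upt_Suc)

lemma sorted_reading_boxes: "sorted_wrt reads_before (reading_boxes \<alpha> \<nu>)"
proof -
  \<comment> \<open>The number of rows read is freed from \<open>length \<alpha>\<close>, so that
    the induction adds one row at a time while \<alpha> stays fixed.\<close>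
  have "sorted_wrt reads_before
    (concat (map (\<lambda>i. map (Pair i) (rev [Suc (row \<nu> i)..<Suc (row \<alpha> i)])) [1..<Suc n]))" for n
  proof (induction n)
    case (Suc n)
    have "sorted_wrt reads_before (map (Pair i) (rev [s..<t]))" for i s t
      by (auto simp: sorted_wrt_map sorted_wrt_rev reads_before_def sorted_wrt_iff_nth_less rev_nth)
    then show ?case
      using Suc by (subst upt_Suc)
        (auto simp: sorted_wrt_append simp del: upt_Suc, auto simp: reads_before_def)
  qed simp
  then show ?thesis by (simp only: reading_boxes_def)
qed

lemma distinct_reading_boxes: "distinct (reading_boxes \<alpha> \<nu>)"
  using sorted_reading_boxes[of \<alpha> \<nu>]
  by (auto simp: distinct_conv_nth sorted_wrt_iff_nth_less reads_before_def)
     (metis nat_neq_iff)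

lemma count_reverse_word: "count_list (reverse_word \<alpha> \<nu> T) x = card {b \<in> skew \<alpha> \<nu>. T b = x}"
proof -
  have "count_list (map T xs) x = card {b \<in> set xs. T b = x}" if "distinct xs" for xs
    using that
  proof (induction xs)
    case (Cons y xs)
    have "{b \<in> set (y # xs). T b = x} =
      (if T y = x then insert y {b \<in> set xs. T b = x} else {b \<in> set xs. T b = x})" by auto
    then show ?case using Cons by simp
  qed simp
  from this[OF distinct_reading_boxes] show ?thesis
    by (simp add: reverse_word_eq set_reading_boxes)
qed

text \<open>The prefix ending with this \<open>Suc l\<close> must also contain an \<open>l\<close>,
  and its last letter is not \<open>l\<close>.\<close>

lemma lattice_word_predecessor:
  assumes "lattice_word w" "1 \<le> l" "p < length w" "w ! p = Suc l"
  shows "\<exists>q<p. w ! q = l"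
proof -
  have "Suc l \<in> set (take (Suc p) w)"
    using assms by (auto simp: in_set_conv_nth)
  then have "count_list (take (Suc p) w) (Suc l) \<noteq> 0" by (simp add: count_list_0_iff)
  then have "count_list (take (Suc p) w) l \<noteq> 0"
    using assms(1-3) unfolding lattice_word_def by (metis Suc_leI le_zero_eq)
  then have "l \<in> set (take (Suc p) w)" using count_notin by metis
  then obtain q where "q < Suc p" "w ! q = l"
    by (auto simp: in_set_conv_nth)
  then show ?thesis using assms(4) by (metis less_Suc_eq n_not_Suc_n)
qed

text \<open>A letter that occurs at most once has count 0 or 1 in every prefix, so a single earlier
  \<open>l\<close> suffices to balance \<open>Suc l\<close>.\<close>

lemma lattice_wordI:
  assumes once: "\<And>l. 1 \<le> l \<Longrightarrow> count_list w (Suc l) \<le> 1"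
    and pred: "\<And>l p. 1 \<le> l \<Longrightarrow> p < length w \<Longrightarrow> w ! p = Suc l \<Longrightarrow> \<exists>q<p. w ! q = l"
  shows "lattice_word w"
  unfolding lattice_word_def
proof (intro allI impI)
  fix l p :: nat
  assume l: "1 \<le> l" and p: "p \<le> length w"
  show "count_list (take p w) (Suc l) \<le> count_list (take p w) l"
  proof (cases "Suc l \<in> set (take p w)")
    case True
    then obtain r where "r < p" "w ! r = Suc l" using p by (auto simp: in_set_conv_nth)
    then obtain q where "q < p" "w ! q = l" using pred[OF l, of r] p
      by (metis order.strict_trans order.strict_trans2)
    then have "l \<in> set (take p w)" using p by (auto simp: in_set_conv_nth)
    then have "1 \<le> count_list (take p w) l" by (simp add: Suc_le_eq count_list_0_iff neq0_conv[symmetric] del: neq0_conv)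
    moreover have "count_list (take p w) (Suc l) \<le> count_list w (Suc l)"
      by (metis append_take_drop_id count_list_append le_add1)
    ultimately show ?thesis using once[OF l] by linarith
  qed simp
qed

text \<open>A row is read weakly decreasingly, so the letter that the lattice condition provides
  before \<open>Suc l\<close> cannot lie in the same row.\<close>

lemma LR_predecessor:
  assumes T: "T \<in> LR \<alpha> \<nu> \<kappa>" and l: "1 \<le> l" and b: "(r, c) \<in> skew \<alpha> \<nu>" "T (r, c) = Suc l"
  obtains r' c' where "(r', c') \<in> skew \<alpha> \<nu>" "T (r', c') = l" "r' < r"
proof -
  let ?B = "reading_boxes \<alpha> \<nu>"
  obtain p where p: "p < length ?B" "?B ! p = (r, c)"
    using b(1) by (metis set_reading_boxes in_set_conv_nth)
  have "lattice_word (map T ?B)" using T by (simp add: LR_def reverse_word_eq)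
  then obtain q where q: "q < p" "T (?B ! q) = l"
    using lattice_word_predecessor[of "map T ?B" l p] l p b by force
  obtain r' c' where b': "?B ! q = (r', c')" by fastforce
  have mem: "(r', c') \<in> skew \<alpha> \<nu>" using p q b' by (metis set_reading_boxes nth_mem order_less_trans)
  have "reads_before (r', c') (r, c)"
    using sorted_wrt_nth_less[OF sorted_reading_boxes q(1) p(1)] b' p by simp
  moreover have "\<not> (r' = r \<and> c < c')"
    using T b mem q b' by (force simp: LR_def semistandard_def)
  ultimately show ?thesis using that[of r' c'] mem q b' by (auto simp: reads_before_def)
qed

text \<open>Converse to \<open>LR_predecessor\<close> for contents whose rows from the second on are
  at most 1, such as hooks and columns: a box in a higher row is read earlier, which is all that the
  lattice condition then asks for.\<close>

lemma LR_I:
  assumes "T \<in> tableaux \<alpha> \<nu>" "\<And>i. row \<nu> i \<le> row \<alpha> i" "semistandard \<alpha> \<nu> T" "has_content \<alpha> \<nu> T \<kappa>"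
    and once: "\<And>i. 2 \<le> i \<Longrightarrow> row \<kappa> i \<le> 1"
    and pred: "\<And>l r c. 1 \<le> l \<Longrightarrow> (r, c) \<in> skew \<alpha> \<nu> \<Longrightarrow> T (r, c) = Suc l \<Longrightarrow>
       \<exists>r' c'. (r', c') \<in> skew \<alpha> \<nu> \<and> T (r', c') = l \<and> r' < r"
  shows "T \<in> LR \<alpha> \<nu> \<kappa>"
proof -
  let ?B = "reading_boxes \<alpha> \<nu>"
  have "lattice_word (reverse_word \<alpha> \<nu> T)"
  proof (rule lattice_wordI)
    show "count_list (reverse_word \<alpha> \<nu> T) (Suc l) \<le> 1" if "1 \<le> l" for l
      using assms(4) once[of "Suc l"] that by (simp add: count_reverse_word has_content_def)
    fix l p
    assume l: "1 \<le> l" and p: "p < length (reverse_word \<alpha> \<nu> T)" "reverse_word \<alpha> \<nu> T ! p = Suc l"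
    then have p': "p < length ?B" "T (?B ! p) = Suc l" by (auto simp: reverse_word_eq)
    obtain r c where b: "?B ! p = (r, c)" by fastforce
    then have "(r, c) \<in> skew \<alpha> \<nu>" using p' by (metis set_reading_boxes nth_mem)
    then obtain r' c' where b': "(r', c') \<in> skew \<alpha> \<nu>" "T (r', c') = l" "r' < r"
      using pred[OF l] p' b by metis
    then obtain q where q: "q < length ?B" "?B ! q = (r', c')"
      by (metis set_reading_boxes in_set_conv_nth)
    have "q < p"
    proof (rule ccontr)
      assume "\<not> q < p"
      then have "p = q \<or> reads_before (?B ! p) (?B ! q)"
        using sorted_wrt_nth_less[OF sorted_reading_boxes, of p q \<alpha> \<nu>] q by force
      then show False using b b' q by (auto simp: reads_before_def)
    qed
    then show "\<exists>q<p. reverse_word \<alpha> \<nu> T ! q = l"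
      using b' q by (intro exI[of _ q]) (auto simp: reverse_word_eq)
  qed
  then show ?thesis using assms(1-4) by (simp add: LR_def diagram_subset_iff)
qed

section \<open>Hook and column contents, and letters in Littlewood-Richardson tableaux\<close>

lemma row_hook: "row (p # replicate k 1) i = (if i = 1 then p else if 2 \<le> i \<and> i \<le> Suc k then 1 else 0)"
  by (auto simp: row_def nth_Cons split: nat.split)

lemma row_replicate: "row (replicate q 1) i = (if 1 \<le> i \<and> i \<le> q then 1 else 0)"
  by (auto simp: row_def)

lemma skew_row_le_length: "(i, j) \<in> skew \<alpha> \<nu> \<Longrightarrow> i \<le> length \<alpha>"
  by (simp add: skew_eq_Sigma)

lemma LR_label_exists:
  assumes "T \<in> LR \<alpha> \<nu> \<kappa>" "1 \<le> l" "1 \<le> row \<kappa> l"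
  obtains r c where "(r, c) \<in> skew \<alpha> \<nu>" "T (r, c) = l"
proof -
  have "card {b \<in> skew \<alpha> \<nu>. T b = l} \<noteq> 0"
    using assms by (simp add: LR_def has_content_def)
  then have "{b \<in> skew \<alpha> \<nu>. T b = l} \<noteq> {}" by force
  then obtain b where "b \<in> skew \<alpha> \<nu>" "T b = l" by blast
  then show ?thesis using that[of "fst b" "snd b"] by simp
qed

lemma LR_label_unique:
  assumes "T \<in> LR \<alpha> \<nu> \<kappa>" "row \<kappa> (T b) \<le> 1" "b \<in> skew \<alpha> \<nu>" "b' \<in> skew \<alpha> \<nu>" "T b' = T b"
  shows "b' = b"
proof -
  have "1 \<le> T b" using assms by (auto simp: LR_def tableaux_def)
  then have "card {c \<in> skew \<alpha> \<nu>. T c = T b} \<le> 1"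
    using assms by (simp add: LR_def has_content_def)
  moreover have "finite {c \<in> skew \<alpha> \<nu>. T c = T b}" by simp
  ultimately have "\<forall>c\<in>{c \<in> skew \<alpha> \<nu>. T c = T b}. \<forall>c'\<in>{c \<in> skew \<alpha> \<nu>. T c = T b}. c = c'"
    by (metis (no_types, lifting) One_nat_def card_le_Suc0_iff_eq)
  then show ?thesis using assms(3-5) by blast
qed

lemma LR_label_in_range:
  assumes "T \<in> LR \<alpha> \<nu> \<kappa>" "b \<in> skew \<alpha> \<nu>"
  shows "1 \<le> T b" "1 \<le> row \<kappa> (T b)"
proof -
  show 1: "1 \<le> T b" using assms by (auto simp: LR_def tableaux_def)
  have "b \<in> {c \<in> skew \<alpha> \<nu>. T c = T b}" using assms by simp
  then have "{c \<in> skew \<alpha> \<nu>. T c = T b} \<noteq> {}" by blast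
  then have "card {c \<in> skew \<alpha> \<nu>. T c = T b} \<noteq> 0" by simp
  moreover have "card {c \<in> skew \<alpha> \<nu>. T c = T b} = row \<kappa> (T b)"
    using assms(1) 1 by (simp add: LR_def has_content_def)
  ultimately show "1 \<le> row \<kappa> (T b)" by simp
qed

text \<open>Passing from a letter to its predecessor moves up at least one row, and rows are
  numbered from 1.\<close>

lemma LR_label_le_row:
  assumes T: "T \<in> LR \<alpha> \<nu> \<kappa>" and "(r, c) \<in> skew \<alpha> \<nu>"
  shows "T (r, c) \<le> r"
proof -
  have "T (r, c) = l \<Longrightarrow> (r, c) \<in> skew \<alpha> \<nu> \<Longrightarrow> l \<le> r" for l
  proof (induction l arbitrary: r c)
    case (Suc l)
    show ?case
    proof (cases "l = 0")
      case True
      then show ?thesis using Suc.prems by (simp add: skew_iff)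
    next
      case False
      then have "1 \<le> l" by simp
      from LR_predecessor[OF T this Suc.prems(2,1)] obtain r' c'
        where "(r', c') \<in> skew \<alpha> \<nu>" "T (r', c') = l" "r' < r" by blast
      then show ?thesis using Suc.IH by fastforce
    qed
  qed simp
  then show ?thesis using assms(2) by simp
qed

lemma LR_row_mono:
  assumes "T \<in> LR \<alpha> \<nu> \<kappa>" "(i, j) \<in> skew \<alpha> \<nu>" "(i, j') \<in> skew \<alpha> \<nu>" "j < j'"
  shows "T (i, j) \<le> T (i, j')"
  using assms unfolding LR_def semistandard_def by blast

lemma LR_column_strict:
  assumes "T \<in> LR \<alpha> \<nu> \<kappa>" "(i, j) \<in> skew \<alpha> \<nu>" "(i', j) \<in> skew \<alpha> \<nu>" "i < i'"
  shows "T (i, j) < T (i', j)"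
  using assms unfolding LR_def semistandard_def by blast

section \<open>Tableaux of hook content\<close>

definition hook_filling :: "nat list \<Rightarrow> nat list \<Rightarrow> nat \<times> nat \<Rightarrow> nat" where
  "hook_filling \<alpha> \<nu> = (\<lambda>(i, j)\<in>skew \<alpha> \<nu>. if 1 < i \<and> j = row \<alpha> i then i else 1)"

text \<open>Letter \<open>m\<close> needs an \<open>m\<close>-th row, and its chain of predecessors
  then meets every row. Row ends are thereby fixed and all other boxes carry 1; column strictness
  among those boxes yields the horizontal strip.\<close>

lemma LR_hook_dest:
  assumes T: "T \<in> LR \<alpha> \<nu> (p # replicate (m - 1) 1)"
    and "1 \<le> p" "1 \<le> m" "length \<alpha> \<le> m" and \<nu>: "is_partition \<nu>" and \<alpha>: "is_partition \<alpha>"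
  shows "length \<alpha> = m"
    and "T = hook_filling \<alpha> \<nu>"
    and "\<And>i. 1 \<le> i \<Longrightarrow> row \<nu> i \<le> row \<alpha> i - 1"
    and "\<And>i. 1 \<le> i \<Longrightarrow> row \<alpha> (Suc i) - 1 \<le> row \<nu> i"
    and "card (skew \<alpha> \<nu>) = p + (m - 1)"
proof -
  let ?\<kappa> = "p # replicate (m - 1) 1"
  \<comment> \<open>Downward induction from \<open>m\<close>. A letter is at most its row number,
    and there are at most \<open>m\<close> rows, so \<open>m\<close> lies in row \<open>m\<close>. A
    predecessor of the \<open>Suc i\<close> in row \<open>Suc i\<close> lies in a row both at most
    and at least \<open>i\<close>.\<close>
  have diag: "\<exists>c. (i, c) \<in> skew \<alpha> \<nu> \<and> T (i, c) = i" if "1 \<le> i" "i \<le> m" for i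
    using that(2,1)
  proof (induction rule: inc_induct)
    case base
    have "1 \<le> row ?\<kappa> m" unfolding row_hook using assms by auto
    then obtain r c where "(r, c) \<in> skew \<alpha> \<nu>" "T (r, c) = m"
      using LR_label_exists[OF T \<open>1 \<le> m\<close>] by blast
    then show ?case
      using LR_label_le_row[OF T, of r c] skew_row_le_length[of r c \<alpha> \<nu>] assms(4)
      by (metis order.antisym order.trans)
  next
    case (step i)
    then obtain c where c: "(Suc i, c) \<in> skew \<alpha> \<nu>" "T (Suc i, c) = Suc i" by auto
    from LR_predecessor[OF T step.prems this] obtain r' c'
      where "(r', c') \<in> skew \<alpha> \<nu>" "T (r', c') = i" "r' < Suc i" by blast
    then show ?case using LR_label_le_row[OF T, of r' c'] by (metis le_antisym less_Suc_eq_le)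
  qed
  \<comment> \<open>Letters from 2 on occur once, so the box is the one that \<open>diag\<close>
    provides.\<close>
  have row_eq: "T (r, c) = r" if b: "(r, c) \<in> skew \<alpha> \<nu>" and ne: "T (r, c) \<noteq> 1" for r c
  proof -
    have "2 \<le> T (r, c)" "T (r, c) \<le> m"
      using LR_label_in_range[OF T b] ne unfolding row_hook by (auto split: if_splits)
    then obtain c' where c': "(T (r, c), c') \<in> skew \<alpha> \<nu>" "T (T (r, c), c') = T (r, c)"
      using diag[of "T (r, c)"] by auto
    have "row ?\<kappa> (T (r, c)) \<le> 1" unfolding row_hook using ne by auto
    from LR_label_unique[OF T this b c'] show ?thesis by simp
  qed
  show len: "length \<alpha> = m"
    using diag[of m] \<open>1 \<le> m\<close> \<open>length \<alpha> \<le> m\<close> skew_row_le_length by (metis order.antisym order.refl)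
  \<comment> \<open>The row increases weakly up to its end, where the letter is still at most
    \<open>i\<close>.\<close>
  have last: "(i, row \<alpha> i) \<in> skew \<alpha> \<nu> \<and> T (i, row \<alpha> i) = i" if i: "1 \<le> i" "i \<le> m" for i
  proof -
    obtain c where c: "(i, c) \<in> skew \<alpha> \<nu>" "T (i, c) = i" using diag i by blast
    then have mem: "(i, row \<alpha> i) \<in> skew \<alpha> \<nu>" by (auto simp: skew_iff)
    have "c = row \<alpha> i \<or> c < row \<alpha> i" using c by (auto simp: skew_iff)
    then have "i \<le> T (i, row \<alpha> i)"
      using LR_row_mono[OF T c(1) mem] c(2) by auto
    then have "T (i, row \<alpha> i) = i" using LR_label_le_row[OF T mem] by simp
    then show ?thesis using mem by simp
  qed
  have entry: "T (i, j) = (if 1 < i \<and> j = row \<alpha> i then i else 1)" if b: "(i, j) \<in> skew \<alpha> \<nu>" for i j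
  proof (cases "T (i, j) = 1")
    case True
    then show ?thesis using last[of i] skew_row_le_length[OF b] len b by (force simp: skew_iff)
  next
    case False
    then have l: "T (i, j) = i" using row_eq b by blast
    have "row ?\<kappa> (T (i, j)) \<le> 1" unfolding row_hook using False by auto
    moreover have "1 < i" "i \<le> m" using False l b skew_row_le_length[OF b] len by (auto simp: skew_iff)
    ultimately have "(i, row \<alpha> i) = (i, j)"
      using LR_label_unique[OF T _ b, of "(i, row \<alpha> i)"] last[of i] l by simp
    then show ?thesis using l \<open>1 < i\<close> by simp
  qed
  show "T = hook_filling \<alpha> \<nu>"
  proof (rule extensionalityI[of _ "skew \<alpha> \<nu>"])
    show "T \<in> extensional (skew \<alpha> \<nu>)" using T by (auto simp: LR_def tableaux_def PiE_def)
  qed (auto simp: hook_filling_def entry)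
  have sub: "row \<nu> i \<le> row \<alpha> i" for i using T by (simp add: LR_def diagram_subset_iff)
  show "row \<nu> i \<le> row \<alpha> i - 1" if "1 \<le> i" for i
    using last[of i] that row_beyond[of \<alpha> i] sub[of i] len by (cases "i \<le> m") (auto simp: skew_iff)
  show "row \<alpha> (Suc i) - 1 \<le> row \<nu> i" if i: "1 \<le> i" for i
  proof (rule ccontr)
    assume "\<not> ?thesis"
    then have lt: "row \<nu> i < row \<alpha> (Suc i) - 1" by simp
    \<comment> \<open>The last box but one of row \<open>Suc i\<close> carries 1, so the box above
      it, if it belonged to the shape, would need a letter below 1.\<close>
    let ?j = "row \<alpha> (Suc i) - 1"
    have "(Suc i, ?j) \<in> skew \<alpha> \<nu>" "(i, ?j) \<in> skew \<alpha> \<nu>"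
      using lt i row_antimono[OF \<nu>, of i "Suc i"] row_antimono[OF \<alpha>, of i "Suc i"]
      by (auto simp: skew_iff)
    moreover from this have "T (Suc i, ?j) = 1" using entry lt by force
    ultimately have "T (i, ?j) < 1"
      using LR_column_strict[OF T, of i ?j "Suc i"] by simp
    then show False using LR_label_in_range[OF T \<open>(i, ?j) \<in> skew \<alpha> \<nu>\<close>] by simp
  qed
  have "T b \<in> {1..m}" if "b \<in> skew \<alpha> \<nu>" for b
    using LR_label_in_range[OF T that] \<open>1 \<le> m\<close> unfolding row_hook by (auto split: if_splits)
  then have "skew \<alpha> \<nu> = (\<Union>l\<in>{1..m}. {b \<in> skew \<alpha> \<nu>. T b = l})" by blast
  then have "card (skew \<alpha> \<nu>) = card (\<Union>l\<in>{1..m}. {b \<in> skew \<alpha> \<nu>. T b = l})" by simp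
  also have "\<dots> = (\<Sum>l=1..m. card {b \<in> skew \<alpha> \<nu>. T b = l})"
    by (rule card_UN_disjoint) auto
  also have "\<dots> = (\<Sum>l=1..m. row ?\<kappa> l)"
    using T by (intro sum.cong) (auto simp: LR_def has_content_def)
  also have "\<dots> = sum_list ?\<kappa>"
    using \<open>1 \<le> m\<close> by (intro sum_list_rows[symmetric]) simp
  finally show "card (skew \<alpha> \<nu>) = p + (m - 1)" by (simp add: sum_list_replicate)
qed

text \<open>The upper bounds put every row end into the shape, the lower bounds give column
  strictness, and the size fixes the number of 1s.\<close>

lemma LR_hookI:
  assumes \<alpha>: "is_partition \<alpha>" and len: "length \<alpha> = m" and m: "1 \<le> m"
    and upper: "\<And>i. 1 \<le> i \<Longrightarrow> row \<nu> i \<le> row \<alpha> i - 1"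
    and lower: "\<And>i. 1 \<le> i \<Longrightarrow> row \<alpha> (Suc i) - 1 \<le> row \<nu> i"
    and p: "card (skew \<alpha> \<nu>) = p + (m - 1)"
  shows "hook_filling \<alpha> \<nu> \<in> LR \<alpha> \<nu> (p # replicate (m - 1) 1)"
proof -
  let ?T = "hook_filling \<alpha> \<nu>" and ?\<kappa> = "p # replicate (m - 1) 1"
  have T: "?T (i, j) = (if 1 < i \<and> j = row \<alpha> i then i else 1)" if "(i, j) \<in> skew \<alpha> \<nu>" for i j
    using that by (simp add: hook_filling_def)
  have last: "(i, row \<alpha> i) \<in> skew \<alpha> \<nu>" if "1 \<le> i" "i \<le> m" for i
    using that upper[of i] row_pos_iff[OF \<alpha>, of i] len by (auto simp: skew_iff)
  show ?thesis
  proof (rule LR_I)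
    show "?T \<in> tableaux \<alpha> \<nu>"
      by (auto simp: tableaux_def hook_filling_def)
    show "row \<nu> i \<le> row \<alpha> i" for i
      using upper[of i] by (cases "i = 0") auto
    show "semistandard \<alpha> \<nu> ?T"
      unfolding semistandard_def
    proof (intro conjI allI impI; elim conjE)
      fix i j j'
      assume "(i, j) \<in> skew \<alpha> \<nu>" "(i, j') \<in> skew \<alpha> \<nu>" "j < j'"
      then show "?T (i, j) \<le> ?T (i, j')" by (auto simp: T skew_iff)
    next
      fix i i' j
      assume b: "(i, j) \<in> skew \<alpha> \<nu>" "(i', j) \<in> skew \<alpha> \<nu>" "i < i'"
      \<comment> \<open>A box with a box of the shape above it must end its row, so it carries
        \<open>i'\<close>, while the upper letter is at most \<open>i\<close>.\<close>
      have "row \<alpha> i' \<le> row \<alpha> (Suc i)" using row_antimono[OF \<alpha>, of "Suc i" i'] b by simp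
      then have "j = row \<alpha> i'" using b lower[of i] by (auto simp: skew_iff)
      then show "?T (i, j) < ?T (i', j)" using b by (auto simp: T skew_iff)
    qed
    have ge2: "{b \<in> skew \<alpha> \<nu>. ?T b = i} = (if i \<le> m then {(i, row \<alpha> i)} else {})" if "2 \<le> i" for i
      using that last[of i] skew_row_le_length[of _ _ \<alpha> \<nu>] len by (auto simp: T split: if_splits)
    have "{b \<in> skew \<alpha> \<nu>. ?T b = 1} = skew \<alpha> \<nu> - (\<lambda>i. (i, row \<alpha> i)) ` {2..m}"
      using skew_row_le_length[of _ _ \<alpha> \<nu>] len by (auto simp: T split: if_splits)
    moreover have "card ((\<lambda>i. (i, row \<alpha> i)) ` {2..m}) = m - 1"
      by (subst card_image) (auto simp: inj_on_def)
    moreover have "(\<lambda>i. (i, row \<alpha> i)) ` {2..m} \<subseteq> skew \<alpha> \<nu>" using last by auto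
    ultimately have eq1: "card {b \<in> skew \<alpha> \<nu>. ?T b = 1} = p"
      using p by (simp add: card_Diff_subset)
    show "has_content \<alpha> \<nu> ?T ?\<kappa>"
      unfolding has_content_def row_hook
    proof (intro allI impI)
      fix i :: nat assume i: "1 \<le> i"
      show "card {b \<in> skew \<alpha> \<nu>. ?T b = i} =
        (if i = 1 then p else if 2 \<le> i \<and> i \<le> Suc (m - 1) then 1 else 0)"
      proof (cases "i = 1")
        case True
        then show ?thesis using eq1 by simp
      next
        case False
        then have "2 \<le> i" using i by simp
        from ge2[OF this] show ?thesis using \<open>2 \<le> i\<close> m by simp
      qed
    qed
    show "row ?\<kappa> i \<le> 1" if "2 \<le> i" for i using that unfolding row_hook by auto
    fix l r c
    assume l: "1 \<le> l" "(r, c) \<in> skew \<alpha> \<nu>" "?T (r, c) = Suc l"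
    then have "r = Suc l" by (auto simp: T split: if_splits)
    moreover from this have "(l, row \<alpha> l) \<in> skew \<alpha> \<nu>"
      using l last[of l] skew_row_le_length[of r c \<alpha> \<nu>] len by simp
    moreover from this have "?T (l, row \<alpha> l) = l" using l by (auto simp: T)
    ultimately show "\<exists>r' c'. (r', c') \<in> skew \<alpha> \<nu> \<and> ?T (r', c') = l \<and> r' < r" by blast
  qed
qed

section \<open>Tableaux of column content\<close>

definition column_filling :: "nat list \<Rightarrow> nat list \<Rightarrow> nat \<times> nat \<Rightarrow> nat" where
  "column_filling \<beta> \<nu> = (\<lambda>b\<in>skew \<beta> \<nu>. card {b' \<in> skew \<beta> \<nu>. fst b' \<le> fst b})"

text \<open>Each letter occurs once and lies strictly below its predecessor, so larger letters lie
  in strictly lower rows. Hence no row has two boxes, and the letters number the boxes from top to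
  bottom, which is what counting the boxes in weakly higher rows does.\<close>

lemma LR_column_dest:
  assumes U: "U \<in> LR \<beta> \<nu> (replicate q 1)"
  shows "U = column_filling \<beta> \<nu>" and "row \<beta> i \<le> Suc (row \<nu> i)"
proof -
  have uniq: "b = b'" if "b \<in> skew \<beta> \<nu>" "b' \<in> skew \<beta> \<nu>" "U b = U b'" for b b'
    using LR_label_unique[OF U _ that(2,1,3)] unfolding row_replicate by simp
  \<comment> \<open>Induction on the larger letter: its predecessor is higher up and either is the
    box \<open>(r, c)\<close> itself or still has a larger letter.\<close>
  have mono: "r < r'" if b: "(r, c) \<in> skew \<beta> \<nu>" and "(r', c') \<in> skew \<beta> \<nu>" "U (r, c) < l" "U (r', c') = l"
    for r c r' c' l
    using that(2-)
  proof (induction l arbitrary: r' c')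
    case (Suc l)
    then have "1 \<le> l" using LR_label_in_range(1)[OF U b] by simp
    from LR_predecessor[OF U this Suc.prems(1,3)] obtain r2 c2
      where b2: "(r2, c2) \<in> skew \<beta> \<nu>" "U (r2, c2) = l" "r2 < r'" by blast
    show ?case
    proof (cases "U (r, c) = l")
      case True
      then show ?thesis using uniq[OF b b2(1)] b2 by simp
    next
      case False
      then show ?thesis using Suc.IH[OF b2(1)] Suc.prems(2) b2 by force
    qed
  qed simp
  have mono': "fst b < fst b'" if "b \<in> skew \<beta> \<nu>" "b' \<in> skew \<beta> \<nu>" "U b < U b'" for b b'
    using mono[of "fst b" "snd b" "fst b'" "snd b'"] that by simp
  have range: "U ` skew \<beta> \<nu> = {1..q}"
  proof
    show "U ` skew \<beta> \<nu> \<subseteq> {1..q}"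
    proof
      fix l assume "l \<in> U ` skew \<beta> \<nu>"
      then obtain b where "b \<in> skew \<beta> \<nu>" "l = U b" by blast
      then show "l \<in> {1..q}"
        using LR_label_in_range[OF U, of b] unfolding row_replicate by (simp split: if_splits)
    qed
    show "{1..q} \<subseteq> U ` skew \<beta> \<nu>"
    proof
      fix l assume "l \<in> {1..q}"
      then have l: "1 \<le> l" "1 \<le> row (replicate q 1) l" unfolding row_replicate by auto
      show "l \<in> U ` skew \<beta> \<nu>"
        using LR_label_exists[OF U l] by (metis image_eqI)
    qed
  qed
  have "U b = column_filling \<beta> \<nu> b" if b: "b \<in> skew \<beta> \<nu>" for b
  proof -
    \<comment> \<open>Ordering boxes by row and by letter agree; since \<open>U\<close> is injective
      with values exactly 1 to \<open>q\<close>, there are \<open>U b\<close> letters up to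
      \<open>U b\<close>.\<close>
    have "{b' \<in> skew \<beta> \<nu>. fst b' \<le> fst b} = {b' \<in> skew \<beta> \<nu>. U b' \<le> U b}"
    proof -
      have "fst b' \<le> fst b \<longleftrightarrow> U b' \<le> U b" if "b' \<in> skew \<beta> \<nu>" for b'
        using mono'[OF b that] mono'[OF that b] uniq[OF that b]
        by (metis leD le_eq_less_or_eq linorder_le_less_linear)
      then show ?thesis by blast
    qed
    moreover have "U ` {b' \<in> skew \<beta> \<nu>. U b' \<le> U b} = {1..U b}"
    proof -
      have "U ` {b' \<in> skew \<beta> \<nu>. U b' \<le> U b} = U ` skew \<beta> \<nu> \<inter> {..U b}" by auto
      also have "\<dots> = {1..U b}"
        using imageI[OF b, of U] unfolding range by auto
      finally show ?thesis .
    qed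
    moreover have "inj_on U {b' \<in> skew \<beta> \<nu>. U b' \<le> U b}" using uniq by (auto simp: inj_on_def)
    ultimately show ?thesis
      using b card_image[of U "{b' \<in> skew \<beta> \<nu>. U b' \<le> U b}"] by (simp add: column_filling_def)
  qed
  then show "U = column_filling \<beta> \<nu>"
    using U by (intro extensionalityI[of _ "skew \<beta> \<nu>"])
      (auto simp: LR_def tableaux_def PiE_def column_filling_def)
  show "row \<beta> i \<le> Suc (row \<nu> i)"
  proof (rule ccontr)
    assume "\<not> ?thesis"
    moreover from this have "i \<noteq> 0" by (cases i) auto
    ultimately have b: "(i, Suc (row \<nu> i)) \<in> skew \<beta> \<nu>" "(i, Suc (Suc (row \<nu> i))) \<in> skew \<beta> \<nu>"
      by (auto simp: skew_iff)
    then have "U (i, Suc (row \<nu> i)) \<noteq> U (i, Suc (Suc (row \<nu> i)))" using uniq by fastforce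
    then show False using mono'[OF b] mono'[OF b(2,1)] by (auto simp: nat_neq_iff)
  qed
qed

lemma inj_on_fst_vertical_strip:
  assumes "\<And>i. row \<beta> i \<le> Suc (row \<nu> i)"
  shows "inj_on fst (skew \<beta> \<nu>)"
proof (rule inj_onI)
  fix b b' assume "b \<in> skew \<beta> \<nu>" "b' \<in> skew \<beta> \<nu>" "fst b = fst b'"
  then show "b = b'" using assms[of "fst b"] by (cases b; cases b') (auto simp: skew_iff)
qed

text \<open>A vertical strip has at most one box per row, so counting from the top numbers its boxes
  without repetition.\<close>

lemma LR_columnI:
  assumes sub: "\<And>i. row \<nu> i \<le> row \<beta> i" and vert: "\<And>i. row \<beta> i \<le> Suc (row \<nu> i)"
  shows "column_filling \<beta> \<nu> \<in> LR \<beta> \<nu> (replicate (card (skew \<beta> \<nu>)) 1)"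
proof -
  let ?S = "skew \<beta> \<nu>" and ?U = "column_filling \<beta> \<nu>"
  have U: "?U b = card {b' \<in> ?S. fst b' \<le> fst b}" if "b \<in> ?S" for b
    using that by (simp add: column_filling_def)
  have mono: "?U b < ?U b'" if "b \<in> ?S" "b' \<in> ?S" "fst b < fst b'" for b b'
  proof -
    have "b' \<in> {c \<in> ?S. fst c \<le> fst b'}" "b' \<notin> {c \<in> ?S. fst c \<le> fst b}" using that by auto
    moreover have "{c \<in> ?S. fst c \<le> fst b} \<subseteq> {c \<in> ?S. fst c \<le> fst b'}" using that by auto
    ultimately show ?thesis
      unfolding U[OF that(1)] U[OF that(2)] by (intro psubset_card_mono) (simp, blast)
  qed
  have inj: "inj_on ?U ?S"
  proof (rule inj_onI)
    fix b b' assume *: "b \<in> ?S" "b' \<in> ?S" "?U b = ?U b'"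
    then have "fst b = fst b'" using mono[of b b'] mono[of b' b] by (metis nat_neq_iff)
    then show "b = b'" using * inj_on_fst_vertical_strip[OF vert] by (meson inj_onD)
  qed
  have ran: "?U b \<in> {1..card ?S}" if "b \<in> ?S" for b
  proof -
    have "card {b} \<le> ?U b" unfolding U[OF that] using that by (intro card_mono) auto
    moreover have "?U b \<le> card ?S" unfolding U[OF that] by (intro card_mono) auto
    ultimately show ?thesis by simp
  qed
  \<comment> \<open>An injective map into a set of the same finite size is onto.\<close>
  have range: "?U ` ?S = {1..card ?S}"
    using ran by (intro card_subset_eq) (auto simp: card_image[OF inj])
  show ?thesis
  proof (rule LR_I)
    show "?U \<in> tableaux \<beta> \<nu>"
      using ran by (auto simp: tableaux_def PiE_def) (auto simp: column_filling_def)
    show "semistandard \<beta> \<nu> ?U"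
      unfolding semistandard_def
    proof (intro conjI allI impI; elim conjE)
      fix i j j'
      assume "(i, j) \<in> ?S" "(i, j') \<in> ?S" "j < j'"
      then show "?U (i, j) \<le> ?U (i, j')" by (simp add: U)
    next
      fix i i' j
      assume "(i, j) \<in> ?S" "(i', j) \<in> ?S" "i < i'"
      then show "?U (i, j) < ?U (i', j)" using mono by simp
    qed
    show "has_content \<beta> \<nu> ?U (replicate (card ?S) 1)"
      unfolding has_content_def row_replicate
    proof (intro allI impI)
      fix l :: nat assume l: "1 \<le> l"
      show "card {b \<in> ?S. ?U b = l} = (if 1 \<le> l \<and> l \<le> card ?S then 1 else 0)"
      proof (cases "l \<le> card ?S")
        case True
        then obtain b where b: "b \<in> ?S" "?U b = l" using l range by (metis atLeastAtMost_iff imageE)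
        then have "{b \<in> ?S. ?U b = l} = {b}" using inj by (auto simp: inj_on_def)
        then show ?thesis using l True by simp
      next
        case False
        then have "{b \<in> ?S. ?U b = l} = {}" using ran by auto
        then show ?thesis using False by simp
      qed
    qed
    show "row (replicate (card ?S) 1) i \<le> 1" for i unfolding row_replicate by simp
    fix l r c
    assume l: "1 \<le> l" "(r, c) \<in> ?S" "?U (r, c) = Suc l"
    then have "l \<in> ?U ` ?S" using range ran[OF l(2)] by auto
    then obtain r' c' where b: "(r', c') \<in> ?S" "?U (r', c') = l" by auto
    moreover have "r' < r"
    proof (rule ccontr)
      assume "\<not> r' < r"
      then have "?U (r, c) \<le> ?U (r', c')"
        unfolding U[OF l(2)] U[OF b(1)] by (intro card_mono) auto
      then show False using b l by simp
    qed
    ultimately show "\<exists>r' c'. (r', c') \<in> ?S \<and> ?U (r', c') = l \<and> r' < r" by blast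
  qed (rule sub)
qed

section \<open>Stabilizations of the empty partition, a row and a column\<close>

lemma durfee_rank_Nil [simp]: "durfee_rank [] = 0"
  unfolding durfee_rank_def by (rule Greatest_equality) (auto simp: row_def split: if_splits)

lemma durfee_rank_singleton: "1 \<le> p \<Longrightarrow> durfee_rank [p] = 1"
  unfolding durfee_rank_def by (rule Greatest_equality) (auto simp: row_def split: if_splits)

lemma durfee_rank_column: "1 \<le> p \<Longrightarrow> durfee_rank (replicate p 1) = 1"
  unfolding durfee_rank_def by (rule Greatest_equality) (auto simp: row_def split: if_splits)

text \<open>The rank is 0, so the added rows are empty and get filtered out.\<close>

lemma stabilization_Nil: "stabilization k [] = []"
  by (simp add: stabilization_def)

lemma stabilization_singleton: "1 \<le> p \<Longrightarrow> stabilization k [p] = p # replicate k 1"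
proof -
  assume p: "1 \<le> p"
  \<comment> \<open>Sorting is increasing, so \<open>p\<close> ends up behind the ones and comes
    first after reversal. For \<open>p = 1\<close> it is inserted in front, which gives the same
    list.\<close>
  have ins: "insort p (replicate k 1) = replicate k 1 @ [p]"
  proof (induction k)
    case (Suc k)
    then show ?case using p by (cases "p = 1") (auto simp: replicate_append_same)
  qed simp
  have "filter ((<) 0) (p # replicate k 1) = p # replicate k (1 :: nat)" using p by simp
  then show ?thesis
    unfolding stabilization_def using p ins
    by (simp add: durfee_rank_singleton)
qed

lemma stabilization_column:
  assumes "1 \<le> p" shows "stabilization k (replicate p 1) = replicate (p + k) 1"
  unfolding stabilization_def durfee_rank_column[OF assms]
  by (simp flip: replicate_add)

lemma conjugate_Nil: "conjugate [] = []"
  by (simp add: conjugate_def row_def)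

lemma conjugate_singleton: "conjugate [p] = replicate p 1"
proof (rule nth_equalityI)
  fix j assume "j < length (conjugate [p])"
  moreover have "{i. (i, Suc j) \<in> diagram [p]} = {1}" if "j < p"
    using that by (auto simp: diagram_def row_def split: if_splits)
  ultimately show "conjugate [p] ! j = replicate p 1 ! j"
    by (simp add: conjugate_def row_def del: upt_Suc)
qed (simp add: conjugate_def row_def)

section \<open>Classification of the elements of \<open>X'\<close> for
  \<open>k = m - 1\<close>\<close>

lemma LR_Nil_iff:
  assumes "is_partition \<alpha>" "is_partition \<nu>"
  shows "T \<in> LR \<alpha> \<nu> [] \<longleftrightarrow> \<nu> = \<alpha> \<and> T = (\<lambda>_. undefined)"
proof
  assume T: "T \<in> LR \<alpha> \<nu> []"
  then have sub: "row \<nu> i \<le> row \<alpha> i" for i by (simp add: LR_def diagram_subset_iff)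
  \<comment> \<open>All rows of the empty content are 0, so no letter can occur.\<close>
  have "b \<notin> skew \<alpha> \<nu>" for b
    using LR_label_in_range[OF T, of b] by (auto simp: row_beyond)
  then have empty: "skew \<alpha> \<nu> = {}" by blast
  have "row \<nu> i = row \<alpha> i" if "1 \<le> i" for i
    using sub[of i] empty that skew_iff[of i "row \<alpha> i" \<alpha> \<nu>] by auto
  then have "\<nu> = \<alpha>" using assms by (intro partition_eqI)
  \<comment> \<open>The only extensional function on the empty shape is constantly
    \<open>undefined\<close>.\<close>
  then show "\<nu> = \<alpha> \<and> T = (\<lambda>_. undefined)"
    using T empty by (auto simp: LR_def tableaux_def)
next
  assume *: "\<nu> = \<alpha> \<and> T = (\<lambda>_. undefined)"
  have "skew \<alpha> \<alpha> = {}" by (simp add: skew_def)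
  then show "T \<in> LR \<alpha> \<nu> []"
    using * by (auto intro!: LR_I simp: tableaux_def semistandard_def has_content_def row_def)
qed

text \<open>With \<open>a\<^sub>i = \<alpha>\<^sub>i - 1\<close>: \<open>a/\<nu>\<close> is a horizontal strip and \<open>\<beta>/\<nu>\<close> a vertical strip. The
  subtraction is truncated, so that \<open>a\<^sub>i = 0\<close> beyond the last row of \<open>\<alpha>\<close>.\<close>

definition interlacing :: "nat list \<Rightarrow> nat list \<Rightarrow> (nat \<Rightarrow> nat) \<Rightarrow> bool" where
  "interlacing \<alpha> \<beta> f \<longleftrightarrow>
     (\<forall>i\<ge>1. row \<alpha> (Suc i) - 1 \<le> f i \<and> f i \<le> row \<alpha> i - 1 \<and> f i \<le> row \<beta> i \<and> row \<beta> i \<le> Suc (f i))"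

lemma interlacing_bounds:
  assumes "interlacing \<alpha> \<beta> f" "1 \<le> i"
  shows "row \<alpha> (Suc i) - 1 \<le> f i" "f i \<le> row \<alpha> i - 1" "f i \<le> row \<beta> i" "row \<beta> i \<le> Suc (f i)"
  using assms unfolding interlacing_def by blast+

text \<open>The hook has size \<open>p + (m - 1)\<close>, so for \<open>length \<alpha> = m\<close>
  the first entry recovers \<open>\<mu> = [p]\<close> from the shape.\<close>

definition hook_quad :: "nat list \<Rightarrow> nat list \<Rightarrow> nat list \<Rightarrow> lr_quad" where
  "hook_quad \<alpha> \<beta> \<nu> =
     (([card (skew \<alpha> \<nu>) - (length \<alpha> - 1)], \<nu>), hook_filling \<alpha> \<nu>, column_filling \<beta> \<nu>)"

text \<open>All row ends of \<alpha> lie in the first shape, and the vertical strip has at most one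
  box per row. These bounds will make \<open>p\<close> positive and let \<open>[p]\<close> fit into
  \<open>n - (m - 1)\<close> columns.\<close>

lemma interlacing_card_skew:
  assumes "is_partition \<alpha>" "is_partition \<nu>" "interlacing \<alpha> \<beta> (row \<nu>)"
  shows "length \<alpha> \<le> card (skew \<alpha> \<nu>)" "card (skew \<alpha> \<nu>) + sum_list \<nu> = sum_list \<alpha>"
    "card (skew \<beta> \<nu>) \<le> length \<beta>" "card (skew \<beta> \<nu>) + sum_list \<nu> = sum_list \<beta>"
proof -
  have sub: "row \<nu> i \<le> row \<alpha> i" "row \<nu> i \<le> row \<beta> i" for i
    using interlacing_bounds[OF assms(3), of i] by (cases i; simp)+
  show "card (skew \<alpha> \<nu>) + sum_list \<nu> = sum_list \<alpha>" "card (skew \<beta> \<nu>) + sum_list \<nu> = sum_list \<beta>"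
    using sub length_le_of_rows_le[OF assms(2)] by (intro card_skew; blast)+
  have "row \<nu> i < row \<alpha> i" if "1 \<le> i" "i \<le> length \<alpha>" for i
  proof -
    have "0 < row \<alpha> i" using row_pos_iff[OF assms(1)] that by blast
    moreover have "row \<nu> i \<le> row \<alpha> i - 1" using interlacing_bounds[OF assms(3)] that by blast
    ultimately show ?thesis by simp
  qed
  then have "(\<lambda>i. (i, row \<alpha> i)) ` {1..length \<alpha>} \<subseteq> skew \<alpha> \<nu>"
    by (auto simp: skew_iff)
  from card_mono[OF finite_skew this] show "length \<alpha> \<le> card (skew \<alpha> \<nu>)"
    by (simp add: card_image inj_on_def)
  have vert: "row \<beta> i \<le> Suc (row \<nu> i)" for i
    using interlacing_bounds[OF assms(3), of i] by (cases i; simp)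
  have "card (skew \<beta> \<nu>) = card (fst ` skew \<beta> \<nu>)"
    using inj_on_fst_vertical_strip[OF vert] by (simp add: card_image)
  also have "\<dots> \<le> card {1..length \<beta>}"
    by (intro card_mono) (auto simp: skew_eq_Sigma)
  finally show "card (skew \<beta> \<nu>) \<le> length \<beta>" by simp
qed

lemma X'_eq:
  assumes "1 \<le> m" "m \<le> n" and \<alpha>: "is_partition \<alpha>" and \<beta>: "is_partition \<beta>"
    and sum: "sum_list \<alpha> = sum_list \<beta>" and "length \<alpha> \<le> m" "length \<beta> \<le> n"
  shows "X' m n \<alpha> \<beta> (m - 1) =
    (if \<alpha> = \<beta> then {(([], \<alpha>), (\<lambda>_. undefined), (\<lambda>_. undefined))} else {}) \<union>
    (if length \<alpha> = m then hook_quad \<alpha> \<beta> ` {\<nu>. is_partition \<nu> \<and> interlacing \<alpha> \<beta> (row \<nu>)} else {})"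
    (is "?L = ?E \<union> ?H")
proof
  show "?L \<subseteq> ?E \<union> ?H"
  proof
    fix \<chi> assume "\<chi> \<in> ?L"
    then obtain \<mu> \<nu> T U where \<chi>: "\<chi> = ((\<mu>, \<nu>), T, U)" and \<mu>: "is_partition \<mu>"
      and \<nu>: "is_partition \<nu>" and fit: "fits \<mu> (m - (m - 1)) (n - (m - 1))"
      and T: "T \<in> LR \<alpha> \<nu> (stabilization (m - 1) \<mu>)"
      and U: "U \<in> LR \<beta> \<nu> (stabilization (m - 1) (conjugate \<mu>))"
      unfolding X'_def by blast
    \<comment> \<open>Here \<open>m - (m - 1) = 1\<close>: the rectangle has a single row.\<close>
    have "length \<mu> \<le> 1" using fit \<open>1 \<le> m\<close> by (simp add: fits_def)
    then consider "\<mu> = []" | p where "\<mu> = [p]" by (cases \<mu>) auto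
    then show "\<chi> \<in> ?E \<union> ?H"
    proof cases
      case 1
      then show ?thesis
        using T U LR_Nil_iff[OF \<alpha> \<nu>] LR_Nil_iff[OF \<beta> \<nu>]
        by (auto simp: \<chi> conjugate_Nil stabilization_Nil)
    next
      case 2
      then have p: "1 \<le> p" using \<mu> by (simp add: is_partition_def)
      have T': "T \<in> LR \<alpha> \<nu> (p # replicate (m - 1) 1)"
        using T by (simp add: 2 stabilization_singleton[OF p])
      have U': "U \<in> LR \<beta> \<nu> (replicate (p + (m - 1)) 1)"
        using U by (simp only: 2 conjugate_singleton stabilization_column[OF p])
      note hook = LR_hook_dest[OF T' p \<open>1 \<le> m\<close> \<open>length \<alpha> \<le> m\<close> \<nu> \<alpha>]
      have "row \<nu> i \<le> row \<beta> i" for i using U' by (simp add: LR_def diagram_subset_iff)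
      then have "interlacing \<alpha> \<beta> (row \<nu>)"
        using hook(3,4) LR_column_dest(2)[OF U'] by (simp add: interlacing_def)
      moreover have "\<chi> = hook_quad \<alpha> \<beta> \<nu>"
        unfolding hook_quad_def \<chi> 2 using hook(1,2,5) LR_column_dest(1)[OF U'] by simp
      ultimately show ?thesis using hook(1) \<nu> by auto
    qed
  qed
  have "?E \<subseteq> ?L"
    using \<alpha> \<beta> by (auto simp: X'_def conjugate_Nil stabilization_Nil LR_Nil_iff fits_def row_def is_partition_def)
  moreover have "?H \<subseteq> ?L"
  proof
    fix \<chi> assume "\<chi> \<in> ?H"
    then obtain \<nu> where len: "length \<alpha> = m" and \<nu>: "is_partition \<nu>" and int: "interlacing \<alpha> \<beta> (row \<nu>)"
      and \<chi>: "\<chi> = hook_quad \<alpha> \<beta> \<nu>" by (auto split: if_splits)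
    define p where "p = card (skew \<alpha> \<nu>) - (m - 1)"
    note card = interlacing_card_skew[OF \<alpha> \<nu> int]
    have p: "1 \<le> p" "card (skew \<alpha> \<nu>) = p + (m - 1)"
      using card(1) len \<open>1 \<le> m\<close> by (auto simp: p_def)
    \<comment> \<open>Equal sizes of \<alpha> and \<beta> give skew shapes of equal size, so one
      \<open>p\<close> serves both contents.\<close>
    have "card (skew \<beta> \<nu>) = p + (m - 1)" using card(2,4) sum p by simp
    moreover have "row \<nu> i \<le> row \<beta> i" "row \<beta> i \<le> Suc (row \<nu> i)" for i
      using interlacing_bounds[OF int, of i] by (cases i; simp)+
    ultimately have "column_filling \<beta> \<nu> \<in> LR \<beta> \<nu> (replicate (p + (m - 1)) 1)"
      using LR_columnI[of \<nu> \<beta>] by simp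
    moreover have "hook_filling \<alpha> \<nu> \<in> LR \<alpha> \<nu> (p # replicate (m - 1) 1)"
      using int by (intro LR_hookI[OF \<alpha> len \<open>1 \<le> m\<close>]) (use p interlacing_bounds in blast)+
    moreover have "fits [p] (m - (m - 1)) (n - (m - 1))"
      using \<open>card (skew \<beta> \<nu>) = p + (m - 1)\<close> card(3) \<open>length \<beta> \<le> n\<close> \<open>1 \<le> m\<close>
      by (auto simp: fits_def row_def)
    moreover have "is_partition [p]" using p by (simp add: is_partition_def)
    moreover have "hook_quad \<alpha> \<beta> \<nu> = (([p], \<nu>), hook_filling \<alpha> \<nu>, column_filling \<beta> \<nu>)"
      by (simp add: hook_quad_def p_def len)
    ultimately show "\<chi> \<in> ?L"
      unfolding \<chi> X'_def using p(1) \<nu>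
      by (simp add: stabilization_singleton conjugate_singleton stabilization_column
          del: One_nat_def)
  qed
  ultimately show "?E \<union> ?H \<subseteq> ?L" by blast
qed

section \<open>A row with two choices\<close>

lemma partition_eq_of_rows_le:
  assumes "is_partition \<mu>" "is_partition \<nu>" "sum_list \<mu> = sum_list \<nu>"
    and le: "\<And>i. 1 \<le> i \<Longrightarrow> row \<nu> i \<le> row \<mu> i"
  shows "\<nu> = \<mu>"
proof -
  have le': "row \<nu> i \<le> row \<mu> i" for i using le by (cases "i = 0") auto
  have "card (skew \<mu> \<nu>) + sum_list \<nu> = sum_list \<mu>"
    by (rule card_skew[OF le' length_le_of_rows_le[OF assms(2) le']])
  then have empty: "skew \<mu> \<nu> = {}" using assms(3) by simp
  have "row \<nu> i = row \<mu> i" if "1 \<le> i" for i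
    using le[OF that] empty that skew_iff[of i "row \<mu> i" \<mu> \<nu>] by auto
  then show ?thesis using assms(1,2) by (intro partition_eqI)
qed

text \<open>If every row of \<open>\<nu>\<close> were forced, then each \<open>\<beta>\<^sub>i\<close> would be \<open>a\<^sub>i + 1\<close> or \<open>a\<^sub>i\<^sub>+\<^sub>1\<close>; the second
  alternative persists in all later rows, which makes \<open>\<alpha>\<close> and \<open>\<beta>\<close> comparable.\<close>

lemma interlacing_free_row:
  assumes \<alpha>: "is_partition \<alpha>" and \<beta>: "is_partition \<beta>" and sum: "sum_list \<alpha> = sum_list \<beta>"
    and ne: "\<alpha> \<noteq> \<beta>" and int: "interlacing \<alpha> \<beta> f"
  obtains i where "1 \<le> i" "Suc (max (row \<alpha> (Suc i) - 1) (row \<beta> i - 1)) = min (row \<alpha> i - 1) (row \<beta> i)"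
proof (rule ccontr)
  note free_row = that
  assume "\<not> thesis"
  then have free: "Suc (max (row \<alpha> (Suc i) - 1) (row \<beta> i - 1)) \<noteq> min (row \<alpha> i - 1) (row \<beta> i)"
    if "1 \<le> i" for i using free_row that by blast
  \<comment> \<open>The interval for \<open>f i\<close> now has one value. It is either
    \<open>row \<alpha> i - 1\<close>, with \<beta> one larger, or \<open>row \<beta> i\<close>
    itself, which then meets the lower bound from \<alpha>. On rows of \<alpha>,
    \<open>Suc (row \<alpha> i - 1)\<close> is \<open>row \<alpha> i\<close>.\<close>
  have forced: "row \<beta> i = Suc (row \<alpha> i - 1) \<or> row \<beta> i = row \<alpha> (Suc i) - 1"
    and upper: "row \<beta> i \<le> Suc (row \<alpha> i - 1)" if i: "1 \<le> i" for i
  proof -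
    have "row \<alpha> (Suc i) - 1 \<le> f i" "f i \<le> row \<alpha> i - 1" "f i \<le> row \<beta> i" "row \<beta> i \<le> Suc (f i)"
      using interlacing_bounds[OF int i] by blast+
    then show "row \<beta> i = Suc (row \<alpha> i - 1) \<or> row \<beta> i = row \<alpha> (Suc i) - 1"
      "row \<beta> i \<le> Suc (row \<alpha> i - 1)" using free[OF i] by linarith+
  qed
  have pos: "0 < row \<alpha> i" if "1 \<le> i" "i \<le> length \<alpha>" for i
    using that row_pos_iff[OF \<alpha>] by blast
  show False
  proof (cases "\<forall>i\<in>{1..length \<alpha>}. row \<beta> i = Suc (row \<alpha> i - 1)")
    case True
    have "row \<alpha> i \<le> row \<beta> i" if "1 \<le> i" for i
      using True pos[of i] row_beyond[of \<alpha> i] that by (cases "i \<le> length \<alpha>") auto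
    then show False using partition_eq_of_rows_le[OF \<beta> \<alpha> sum[symmetric]] ne by blast
  next
    case False
    then obtain t where t: "1 \<le> t" "t \<le> length \<alpha>" "row \<beta> t \<noteq> Suc (row \<alpha> t - 1)" by auto
    have later: "row \<beta> i = row \<alpha> (Suc i) - 1" if "t \<le> i" for i
      using that
    proof (induction rule: dec_induct)
      case base
      then show ?case using forced[of t] t by blast
    next
      case (step i)
      \<comment> \<open>This bound, from \<open>row \<beta> (Suc i) \<le> row \<beta> i\<close>,
        rules out the first alternative for \<open>Suc i\<close>.\<close>
      then have "row \<beta> (Suc i) \<le> row \<alpha> (Suc i) - 1"
        using row_antimono[OF \<beta>, of i "Suc i"] t by simp
      then show ?case using forced[of "Suc i"] by simp
    qed
    have "row \<beta> i \<le> row \<alpha> i" if "1 \<le> i" for i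
    proof (cases "t \<le> i")
      case True
      then show ?thesis using later row_antimono[OF \<alpha> that, of "Suc i"] by simp
    next
      case False
      then show ?thesis using upper[OF that] pos[OF that] t by simp
    qed
    then show False using partition_eq_of_rows_le[OF \<alpha> \<beta> sum] ne by blast
  qed
qed

section \<open>The sign-reversing involution\<close>

lemma quad_sign_hook_quad:
  "quad_sign (hook_quad \<alpha> \<beta> \<nu>) = (- 1) ^ (card (skew \<alpha> \<nu>) - (length \<alpha> - 1))"
  by (simp add: quad_sign_def hook_quad_def)

theorem theorem5p8:
  fixes m n :: nat and \<alpha> \<beta> :: "nat list"
  assumes "1 \<le> m" and "m \<le> n"
    and "is_partition \<alpha>" and "is_partition \<beta>"
    and "sum_list \<alpha> = sum_list \<beta>"
    and "length \<alpha> \<le> m" and "length \<beta> \<le> n"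
    and "\<alpha> \<noteq> \<beta> \<or> (\<alpha> = \<beta> \<and> length \<alpha> = m)"
  shows "\<exists>\<phi>. \<phi> \<in> X' m n \<alpha> \<beta> (m - 1) \<rightarrow> X' m n \<alpha> \<beta> (m - 1) \<and>
    (\<forall>\<chi> \<in> X' m n \<alpha> \<beta> (m - 1). \<phi> (\<phi> \<chi>) = \<chi> \<and> quad_sign (\<phi> \<chi>) = - quad_sign \<chi>)"
proof -
  let ?N = "{\<nu>. is_partition \<nu> \<and> interlacing \<alpha> \<beta> (row \<nu>)}"
  note X' = X'_eq[OF assms(1-7)]
  note \<alpha> = \<open>is_partition \<alpha>\<close> and \<beta> = \<open>is_partition \<beta>\<close> and sum = \<open>sum_list \<alpha> = sum_list \<beta>\<close>
  have pos: "0 < row \<alpha> i" if "1 \<le> i" "i \<le> length \<alpha>" for i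
    using that row_pos_iff[OF \<alpha>] by blast
  show ?thesis
  proof (cases "\<alpha> = \<beta>")
    case eq: True
    then have len: "length \<alpha> = m" using assms(8) by simp
    \<comment> \<open>For \<open>\<alpha> = \<beta>\<close> the upper bound from \<alpha> and the
      vertical strip condition leave only \<alpha> without its first column.\<close>
    obtain \<nu> where \<nu>: "is_partition \<nu>" "\<And>i. 1 \<le> i \<Longrightarrow> row \<nu> i = row \<alpha> i - 1"
      by (rule partition_of_rows[of "\<lambda>i. row \<alpha> i - 1" "length \<alpha>"])
        (auto simp: row_beyond intro!: diff_le_mono row_antimono[OF \<alpha>])
    have int: "interlacing \<alpha> \<beta> (row \<nu>)"
      unfolding interlacing_def using \<nu>(2) eq row_antimono[OF \<alpha>] by (auto intro: diff_le_mono)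
    have "?N = {\<nu>}"
    proof (intro equalityI subsetI)
      fix \<nu>' assume "\<nu>' \<in> ?N"
      then have \<nu>': "is_partition \<nu>'" "interlacing \<alpha> \<beta> (row \<nu>')" by auto
      have "row \<nu>' i = row \<nu> i" if i: "1 \<le> i" for i
      proof -
        have "row \<nu>' i \<le> row \<alpha> i - 1" "row \<alpha> i \<le> Suc (row \<nu>' i)"
          using interlacing_bounds[OF \<nu>'(2) i] eq by blast+
        then show ?thesis using \<nu>(2)[OF i] by linarith
      qed
      then show "\<nu>' \<in> {\<nu>}" using partition_eqI[OF \<nu>'(1) \<nu>(1)] by blast
    qed (use \<nu> int in auto)
    define \<chi>\<^sub>0 :: lr_quad where "\<chi>\<^sub>0 = (([], \<alpha>), (\<lambda>_. undefined), (\<lambda>_. undefined))"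
    define \<chi>\<^sub>1 where "\<chi>\<^sub>1 = hook_quad \<alpha> \<beta> \<nu>"
    have X'2: "X' m n \<alpha> \<beta> (m - 1) = {\<chi>\<^sub>0, \<chi>\<^sub>1}"
      unfolding X' \<open>?N = {\<nu>}\<close> \<chi>\<^sub>0_def \<chi>\<^sub>1_def using eq len by auto
    have "skew \<alpha> \<nu> = (\<lambda>i. (i, row \<alpha> i)) ` {1..length \<alpha>}"
      unfolding skew_eq_Sigma using \<nu>(2) pos by (fastforce simp: image_iff)
    \<comment> \<open>One box per row means \<open>p = 1\<close>, hence sign -1, opposite to that of
      the empty \<mu>.\<close>
    then have "card (skew \<alpha> \<nu>) = m" using len by (simp add: card_image inj_on_def)
    then have "quad_sign \<chi>\<^sub>1 = - 1"
      using len \<open>1 \<le> m\<close> by (simp add: \<chi>\<^sub>1_def quad_sign_hook_quad)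
    moreover have "quad_sign \<chi>\<^sub>0 = 1" by (simp add: \<chi>\<^sub>0_def quad_sign_def)
    ultimately show ?thesis
      unfolding X'2 by (intro exI[of _ "\<lambda>\<chi>. if \<chi> = \<chi>\<^sub>0 then \<chi>\<^sub>1 else \<chi>\<^sub>0"]) auto
  next
    case ne: False
    show ?thesis
    proof (cases "length \<alpha> = m \<and> ?N \<noteq> {}")
      case False
      then have "X' m n \<alpha> \<beta> (m - 1) = {}" unfolding X' using ne by auto
      then show ?thesis by auto
    next
      case True
      then have len: "length \<alpha> = m" and "\<exists>\<nu>. interlacing \<alpha> \<beta> (row \<nu>)" by auto
      \<comment> \<open>The existence of one \<nu> yields \<open>r\<close>, but the condition on
        \<open>r\<close> involves only \<alpha> and \<beta>, so the same row can be switched for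
        every \<nu>.\<close>
      then obtain r where r: "1 \<le> r"
        and free: "Suc (max (row \<alpha> (Suc r) - 1) (row \<beta> r - 1)) = min (row \<alpha> r - 1) (row \<beta> r)"
        using interlacing_free_row[OF \<alpha> \<beta> sum ne] by metis
      define lo where "lo = max (row \<alpha> (Suc r) - 1) (row \<beta> r - 1)"
      have X'H: "X' m n \<alpha> \<beta> (m - 1) = hook_quad \<alpha> \<beta> ` ?N" unfolding X' using ne len by simp
      \<comment> \<open>Reflection in row \<open>r\<close>, exchanging the two admissible values
        \<open>lo\<close> and \<open>Suc lo\<close>.\<close>
      define flip where "flip f = f(r := 2 * lo + 1 - f r)" for f :: "nat \<Rightarrow> nat"
      have lo: "f r = lo \<or> f r = Suc lo" if "interlacing \<alpha> \<beta> f" for f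
      proof -
        have "row \<alpha> (Suc r) - 1 \<le> f r" "f r \<le> row \<alpha> r - 1" "f r \<le> row \<beta> r" "row \<beta> r \<le> Suc (f r)"
          using interlacing_bounds[OF that r] by blast+
        then show ?thesis using free unfolding lo_def by linarith
      qed
      have flip_int: "interlacing \<alpha> \<beta> (flip f)" if f: "interlacing \<alpha> \<beta> f" for f
        unfolding interlacing_def
      proof (intro allI impI)
        fix i :: nat assume i: "1 \<le> i"
        show "row \<alpha> (Suc i) - 1 \<le> flip f i \<and> flip f i \<le> row \<alpha> i - 1 \<and>
          flip f i \<le> row \<beta> i \<and> row \<beta> i \<le> Suc (flip f i)"
        proof (cases "i = r")
          case True
          then have "flip f i = lo \<or> flip f i = Suc lo" using lo[OF f] by (auto simp: flip_def)
          then show ?thesis using free unfolding lo_def True by linarith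
        next
          case False
          then show ?thesis using f i by (simp add: flip_def interlacing_def)
        qed
      qed
      have "\<exists>\<nu>'\<in>?N. \<forall>i\<ge>1. row \<nu>' i = flip (row \<nu>) i" if \<nu>: "\<nu> \<in> ?N" for \<nu>
      proof -
        have int: "interlacing \<alpha> \<beta> (flip (row \<nu>))" using \<nu> flip_int by blast
        have bounds: "row \<alpha> (Suc i) - 1 \<le> flip (row \<nu>) i" "flip (row \<nu>) i \<le> row \<alpha> i - 1"
          if "1 \<le> i" for i
          using interlacing_bounds[OF int that] by blast+
        \<comment> \<open>The value \<open>row \<alpha> (Suc i) - 1\<close> bounds row
          \<open>Suc i\<close> from above and row \<open>i\<close> from below, so interlacing alone
          makes the rows decrease.\<close>
        have "flip (row \<nu>) (Suc i) \<le> flip (row \<nu>) i" if "1 \<le> i" for i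
          using bounds(1)[OF that] bounds(2)[of "Suc i"] by simp
        moreover have "flip (row \<nu>) (Suc (length \<alpha>)) = 0"
          using bounds(2)[of "Suc (length \<alpha>)"] by (simp add: row_beyond)
        ultimately obtain \<nu>' where \<nu>': "is_partition \<nu>'" "\<And>i. 1 \<le> i \<Longrightarrow> row \<nu>' i = flip (row \<nu>) i"
          using partition_of_rows[of "flip (row \<nu>)" "length \<alpha>"] by blast
        then have "interlacing \<alpha> \<beta> (row \<nu>')" using int by (simp add: interlacing_def)
        then show ?thesis using \<nu>' by blast
      qed
      then have "\<forall>\<nu>\<in>?N. \<exists>\<nu>'. \<nu>' \<in> ?N \<and> (\<forall>i\<ge>1. row \<nu>' i = flip (row \<nu>) i)" by blast
      from bchoice[OF this] obtain tog
        where tog: "\<And>\<nu>. \<nu> \<in> ?N \<Longrightarrow> tog \<nu> \<in> ?N"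
          and tog_row: "\<And>\<nu> i. \<nu> \<in> ?N \<Longrightarrow> 1 \<le> i \<Longrightarrow> row (tog \<nu>) i = flip (row \<nu>) i" by blast
      have tog_tog: "tog (tog \<nu>) = \<nu>" if \<nu>: "\<nu> \<in> ?N" for \<nu>
      proof (rule partition_eqI)
        show "is_partition (tog (tog \<nu>))" "is_partition \<nu>" using \<nu> tog[OF tog[OF \<nu>]] by blast+
        show "row (tog (tog \<nu>)) i = row \<nu> i" if "1 \<le> i" for i
        proof -
          have "row \<nu> r = lo \<or> row \<nu> r = Suc lo" using \<nu> lo by blast
          then show ?thesis
            using tog_row[OF tog[OF \<nu>] that] tog_row[OF \<nu> r] tog_row[OF \<nu> that]
            unfolding flip_def by (cases "i = r") auto
        qed
      qed
      have sign: "quad_sign (hook_quad \<alpha> \<beta> (tog \<nu>)) = - quad_sign (hook_quad \<alpha> \<beta> \<nu>)"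
        if \<nu>: "\<nu> \<in> ?N" for \<nu>
      proof -
        \<comment> \<open>A common range for both row sums, which then differ only in the term for
          \<open>r\<close>.\<close>
        define K where "K = max r (max (length \<nu>) (length (tog \<nu>)))"
        have K: "r \<in> {1..K}" using r by (simp add: K_def)
        have "sum_list \<mu> = row \<mu> r + (\<Sum>i\<in>{1..K} - {r}. row \<mu> i)" if "length \<mu> \<le> K" for \<mu>
          using sum_list_rows[OF that] sum.remove[OF _ K, of "row \<mu>"] by simp
        from this[of \<nu>] this[of "tog \<nu>"]
        have "sum_list \<nu> = row \<nu> r + (\<Sum>i\<in>{1..K} - {r}. row \<nu> i)"
          "sum_list (tog \<nu>) = row (tog \<nu>) r + (\<Sum>i\<in>{1..K} - {r}. row (tog \<nu>) i)"
          by (simp_all add: K_def)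
        moreover have "(\<Sum>i\<in>{1..K} - {r}. row (tog \<nu>) i) = (\<Sum>i\<in>{1..K} - {r}. row \<nu> i)"
          by (intro sum.cong) (auto simp: tog_row[OF \<nu>] flip_def)
        moreover have "row (tog \<nu>) r = 2 * lo + 1 - row \<nu> r"
          using tog_row[OF \<nu> r] by (simp add: flip_def)
        ultimately have parity: "sum_list (tog \<nu>) = Suc (sum_list \<nu>) \<or> sum_list \<nu> = Suc (sum_list (tog \<nu>))"
          using lo[of "row \<nu>"] \<nu> by auto
        \<comment> \<open>Both shapes have at least \<open>length \<alpha>\<close> boxes, so the
          truncated subtractions in \<open>p\<close> and \<open>q\<close> are exact and these differ
          by 1.\<close>
        have card: "length \<alpha> \<le> card (skew \<alpha> \<mu>)" "card (skew \<alpha> \<mu>) + sum_list \<mu> = sum_list \<alpha>"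
          if "\<mu> \<in> ?N" for \<mu>
          using interlacing_card_skew[OF \<alpha>, of \<mu> \<beta>] that by auto
        define p q where "p = card (skew \<alpha> \<nu>) - (length \<alpha> - 1)"
          and "q = card (skew \<alpha> (tog \<nu>)) - (length \<alpha> - 1)"
        have "p = Suc q \<or> q = Suc p"
          using parity card[OF \<nu>] card[OF tog[OF \<nu>]] unfolding p_def q_def by linarith
        then show ?thesis
          unfolding quad_sign_hook_quad p_def[symmetric] q_def[symmetric] by auto
      qed
      \<comment> \<open>An element stores its own \<nu>, so the map can be defined on elements
        directly.\<close>
      have index: "snd (fst (hook_quad \<alpha> \<beta> \<nu>)) = \<nu>" for \<nu> by (simp add: hook_quad_def)
      let ?\<phi> = "\<lambda>\<chi>. hook_quad \<alpha> \<beta> (tog (snd (fst \<chi>)))"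
      show ?thesis
        unfolding X'H
      proof (intro exI[of _ ?\<phi>] conjI funcsetI ballI)
        fix \<chi> assume "\<chi> \<in> hook_quad \<alpha> \<beta> ` ?N"
        then obtain \<nu> where \<nu>: "\<nu> \<in> ?N" and \<chi>: "\<chi> = hook_quad \<alpha> \<beta> \<nu>" by blast
        show "?\<phi> \<chi> \<in> hook_quad \<alpha> \<beta> ` ?N" unfolding \<chi> index using tog[OF \<nu>] by (rule imageI)
        show "?\<phi> (?\<phi> \<chi>) = \<chi>" unfolding \<chi> index tog_tog[OF \<nu>] ..
        show "quad_sign (?\<phi> \<chi>) = - quad_sign \<chi>" unfolding \<chi> index by (rule sign[OF \<nu>])
      qed
    qed
  qed
qed

end
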